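(* Let $\mathbf{X}=(X_1,\ldots,X_n)$ be a random vector with distribution $\mathbf{F}$ and $Y$ a random variable with distribution $G$, where $G(0-)=0$ and $G(0)<1$. Let $\mathbf{H}$ denote the distribution of $Y\mathbf{X}$, with tail $\overline{\mathbf{H}}(\mathbf{t},x)=\mathbf{P}[YX_1>t_1x,\ldots,YX_n>t_nx]$. Suppose that $Y$ and $\mathbf{X}$ are independent and that there exists a function $a:[0,\infty)\to[0,\infty)$ such that, as $x\to\infty$, (1) $a(x)\to\infty$; (2) $a(x)=o(x)$; (3) $\overline{G}[a(x)]=o[\overline{\mathbf{H}}(\mathbf{t},x)]$ for any $\mathbf{t}\in(0,\infty]^n\setminus\{(\infty,\ldots,\infty)\}$. If $\mathbf{F}\in\mathcal{D}_n$, then $\mathbf{H}\in\mathcal{D}_n$.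
   Context: For a univariate distribution $F$ write $\overline{F}:=1-F$; throughout $\overline{F}(x)>0$ for all $x\ge0$. $f\asymp g$ means $f=O(g)$ and $g=O(f)$ as $x\to\infty$. $F\in\mathcal{D}$ (dominatedly varying) if for all (equivalently, for some) $b\in(0,1)$, $\limsup_{x\to\infty}\overline{F}(bx)/\overline{F}(x)<\infty$. For a random vector $\mathbf{X}$ with distribution $\mathbf{F}$, the tail is $\overline{\mathbf{F}}(\mathbf{t},x)=\mathbf{P}[X_1>t_1x,\ldots,X_n>t_nx]$ for $\mathbf{t}\in(0,\infty]^n\setminus\{(\infty,\ldots,\infty)\}$; if $t_i=\infty$ the dimension is reduced, i.e. the $i$-th component is dropped. $\mathbf{b}\,\mathbf{t}=(b_1t_1,\ldots,b_nt_n)$. $\mathbf{F}\in\mathcal{D}_n$ (multivariate dominatedly varying) if there is a univariate $F\in\mathcal{D}$ (called a weak kernel) with $\overline{F}_i(x)\asymp\overline{F}(x)$ as $x\to\infty$ for every marginal $F_i$, $i=1,\ldots,n$, and $\limsup_{x\to\infty}\overline{\mathbf{F}}(\mathbf{b}\,\mathbf{t},x)/\overline{\mathbf{F}}(\mathbf{t},x)<\infty$ for all $\mathbf{t}\in(0,\infty]^n\setminus\{(\infty,\ldots,\infty)\}$ and all (equivalently, for some) $\mathbf{b}\in(0,1)^n$. (Writing this quotient presupposes that the joint tail is positive.) *)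

theory Defs
  imports "HOL-Probability.Probability" "HOL-Library.Landau_Symbols"
begin

text \<open>
  Distributions are Borel probability measures, on \<^typ>\<open>real\<close> or on \<^typ>\<open>real^'n\<close>.
\<close>

definition ccdf :: "real measure \<Rightarrow> real \<Rightarrow> real" where
  "ccdf F x = 1 - cdf F x"

text \<open>
  The limit superior is taken in \<^typ>\<open>ereal\<close>. Since the tail is required to be positive on
  the half-line, the quotient is never a division by zero for \<open>x \<ge> 0\<close>.
\<close>

definition dominatedly_varying :: "real measure set" where
  "dominatedly_varying =
     {F. real_distribution F \<and> (\<forall>x\<ge>0. ccdf F x > 0) \<and>
         (\<forall>b\<in>{0<..<1}. Limsup at_top (\<lambda>x. ereal (ccdf F (b * x) / ccdf F x)) < \<infinity>)}"

definition directions :: "(ereal^'n) set" where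
  "directions = {t. (\<forall>i. 0 < t $ i) \<and> (\<exists>i. t $ i \<noteq> \<infinity>)}"

text \<open>
  A coordinate with \<open>t $ i = \<infinity>\<close> imposes no condition, i.e. that component is dropped.
\<close>

definition mtail :: "(real^'n) measure \<Rightarrow> ereal^'n \<Rightarrow> real \<Rightarrow> real" where
  "mtail F t x = measure F {v. \<forall>i. t $ i \<noteq> \<infinity> \<longrightarrow> v $ i > real_of_ereal (t $ i) * x}"

lemma mtail_distr:
  fixes X :: "'a \<Rightarrow> real^'n"
  assumes "X \<in> borel_measurable M"
  shows "mtail (distr M borel X) t x =
    measure M {\<omega> \<in> space M. \<forall>i. t $ i \<noteq> \<infinity> \<longrightarrow> X \<omega> $ i > real_of_ereal (t $ i) * x}"
proof -
  have "{v :: real^'n. \<forall>i. t $ i \<noteq> \<infinity> \<longrightarrow> v $ i > real_of_ereal (t $ i) * x} \<in> sets borel"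
    by measurable
  then show ?thesis
    unfolding mtail_def using assms
    by (subst measure_distr) (auto intro!: arg_cong[where f = "measure M"])
qed

definition marginal :: "(real^'n) measure \<Rightarrow> 'n \<Rightarrow> real measure" where
  "marginal F i = distr F borel (\<lambda>v. v $ i)"

definition scale_direction :: "real^'n \<Rightarrow> ereal^'n \<Rightarrow> ereal^'n" where
  "scale_direction b t = (\<chi> i. ereal (b $ i) * t $ i)"

text \<open>
  The quotient of joint tails presupposes that the joint tail is positive; this is part
  of the definition. As the joint tail is nonincreasing in \<open>x \<ge> 0\<close>, positivity for all \<open>x \<ge> 0\<close> and
  positivity for all large \<open>x\<close> are the same condition.
\<close>

definition mv_dominatedly_varying :: "(real^'n) measure set" where
  "mv_dominatedly_varying =
     {F. prob_space F \<and> sets F = sets borel \<and>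
         (\<forall>t\<in>directions. \<forall>x\<ge>0. mtail F t x > 0) \<and>
         (\<exists>K\<in>dominatedly_varying. \<forall>i. ccdf (marginal F i) \<in> \<Theta>(ccdf K)) \<and>
         (\<forall>t\<in>directions. \<forall>b. (\<forall>i. b $ i \<in> {0<..<1}) \<longrightarrow>
            Limsup at_top (\<lambda>x. ereal (mtail F (scale_direction b t) x / mtail F t x)) < \<infinity>)}"

end

theory Submission
  imports Defs
begin

text \<open>
  Condition on \<open>Y = y\<close>. Since \<open>Y\<close> is almost surely nonnegative, the tail of \<open>Y X\<close> in direction
  \<open>t\<close> at level \<open>x\<close> is an average, over \<open>y > 0\<close>, of the tails of \<open>X\<close> in the same direction \<open>t\<close> at
  the levels \<open>x / y\<close>; the value \<open>y = 0\<close> contributes nothing. A bound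
  \<open>mtail F s u \<le> C * mtail F t u\<close> that is known only for large \<open>u\<close> can therefore be integrated over
  the values \<open>y \<le> a x\<close>, because there \<open>x / y \<ge> x / a x\<close>, which is large as \<open>a x = o(x)\<close>. The
  remaining event \<open>Y > a x\<close> has probability \<open>o(mtail H t x)\<close> by assumption. Hence every comparison
  \<open>mtail F s \<in> O(mtail F t)\<close> between two directions is inherited by the law \<open>H\<close> of \<open>Y X\<close>:
  this is \<open>mtail_mix_bigo\<close>.

  This one transfer principle gives both halves of multivariate dominated variation. With
  \<open>s = b t\<close> it gives the bounded quotients of the joint tails. With \<open>s\<close> and \<open>t\<close> two coordinate
  directions, in which the joint tail is the tail of a marginal, it shows that all marginals of
  \<open>H\<close> have tails of the same order, since those of \<open>F\<close> are all of the order of its weak kernel.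
  Any marginal of \<open>H\<close> is then a weak kernel: its own dominated variation is the case of a
  coordinate direction and a constant vector \<open>b\<close>. Positivity of the joint tail of \<open>H\<close>
  (\<open>mtail_mix_pos\<close>) holds because \<open>Y\<close> exceeds some \<open>d > 0\<close> with positive probability.
\<close>

section \<open>Directional tail sets\<close>

definition tail_set :: "ereal^'n \<Rightarrow> real \<Rightarrow> (real^'n) set" where
  "tail_set t x = {v. \<forall>i. t $ i \<noteq> \<infinity> \<longrightarrow> v $ i > real_of_ereal (t $ i) * x}"

lemma mtail_eq_measure_tail_set: "mtail F t x = measure F (tail_set t x)"
  by (simp add: mtail_def tail_set_def)

lemma tail_set_measurable [measurable]: "tail_set t x \<in> sets borel"
  unfolding tail_set_def by measurable

lemma tail_set_antimono:
  assumes "t \<in> directions" "x \<le> y"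
  shows "tail_set t y \<subseteq> tail_set t x"
proof
  fix v assume v: "v \<in> tail_set t y"
  have "real_of_ereal (t $ i) * x < v $ i" if "t $ i \<noteq> \<infinity>" for i
  proof -
    have "0 \<le> real_of_ereal (t $ i)"
      using assms(1) by (intro real_of_ereal_pos) (auto simp: directions_def intro: less_imp_le)
    then have "real_of_ereal (t $ i) * x \<le> real_of_ereal (t $ i) * y"
      using assms(2) by (rule mult_left_mono[rotated])
    also have "\<dots> < v $ i" using v that by (simp add: tail_set_def)
    finally show ?thesis .
  qed
  then show "v \<in> tail_set t x" by (simp add: tail_set_def)
qed

text \<open>
  Homogeneity of the tail sets: a scalar factor on the vector only changes the level and leaves
  the direction alone, which is what makes the tail of a product an average of tails.
\<close>

lemma scaleR_mem_tail_set_iff: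
  assumes "y > 0"
  shows "y *\<^sub>R v \<in> tail_set t x \<longleftrightarrow> v \<in> tail_set t (x / y)"
  using assms by (simp add: tail_set_def pos_divide_less_eq mult.commute)

lemma zero_notin_tail_set:
  assumes "t \<in> directions" "0 \<le> x"
  shows "0 \<notin> tail_set t x"
proof -
  obtain i where "t $ i \<noteq> \<infinity>" "0 < t $ i"
    using assms(1) by (auto simp: directions_def)
  then have "0 \<le> real_of_ereal (t $ i) * x"
    using assms(2) by (intro mult_nonneg_nonneg real_of_ereal_pos) auto
  then show ?thesis
    using \<open>t $ i \<noteq> \<infinity>\<close> by (force simp: tail_set_def)
qed

text \<open>
  The direction that drops every component but one, so that marginal tails become joint tails and
  the results on directions apply to them.
\<close>

definition axis_direction :: "'n \<Rightarrow> ereal^'n" where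
  "axis_direction i = (\<chi> j. if j = i then 1 else \<infinity>)"

lemma axis_direction_in_directions: "axis_direction i \<in> directions"
  by (auto simp: axis_direction_def directions_def intro!: exI[of _ i])

lemma tail_set_axis_direction: "tail_set (axis_direction i) x = {v. v $ i > x}"
  by (auto simp: axis_direction_def tail_set_def)

lemma scale_direction_in_directions:
  assumes "t \<in> directions" "\<And>i. 0 < b $ i"
  shows "scale_direction b t \<in> directions"
proof -
  obtain i where i: "t $ i \<noteq> \<infinity>" using assms(1) by (auto simp: directions_def)
  have "ereal (b $ i) * t $ i \<noteq> \<infinity>"
    using i assms by (cases "t $ i") (auto simp: directions_def)
  moreover have "0 < ereal (b $ j) * t $ j" for j
    using assms by (auto simp: directions_def ereal_zero_less_0_iff)
  ultimately show ?thesis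
    by (auto simp: directions_def scale_direction_def)
qed

lemma ccdf_distr_eq_measure:
  assumes "prob_space F" "f \<in> borel_measurable F"
  shows "ccdf (distr F borel f) x = measure F {v \<in> space F. f v > x}"
proof -
  interpret prob_space F by fact
  have "cdf (distr F borel f) x = prob {v \<in> space F. f v \<le> x}"
    unfolding cdf_def using assms(2)
    by (subst measure_distr) (auto intro!: arg_cong[where f = prob])
  moreover have "prob {v \<in> space F. \<not> f v \<le> x} = 1 - prob {v \<in> space F. f v \<le> x}"
    using assms(2) by (intro prob_neg) measurable
  ultimately show ?thesis by (simp add: ccdf_def not_le)
qed

lemma ccdf_marginal_eq_mtail:
  assumes "prob_space F" "sets F = sets borel"
  shows "ccdf (marginal F i) = mtail F (axis_direction i)"
proof
  fix x
  have "(\<lambda>v. v $ i) \<in> borel_measurable F"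
    by (subst measurable_cong_sets[OF assms(2) refl]) measurable
  then show "ccdf (marginal F i) x = mtail F (axis_direction i) x"
    using assms sets_eq_imp_space_eq[OF assms(2)]
    by (simp add: marginal_def ccdf_distr_eq_measure mtail_eq_measure_tail_set
        tail_set_axis_direction)
qed

text \<open>
  Rescaling the level of a marginal tail is the same as rescaling its direction, since the infinite
  coordinates absorb the factor. Univariate dominated variation of a marginal thus becomes a
  statement about joint tails.
\<close>

lemma mtail_axis_direction_mult:
  assumes "0 < c"
  shows "mtail F (axis_direction i) (c * x) =
    mtail F (scale_direction (\<chi> j. c) (axis_direction i)) x"
  using assms
  by (auto simp: mtail_eq_measure_tail_set tail_set_def scale_direction_def axis_direction_def
      intro!: arg_cong[where f = "measure F"])

section \<open>Bounded quotients\<close>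

text \<open>
  Turns the finite limits superior of the definitions into Landau symbols, which compose and
  transfer more easily.
\<close>

lemma Limsup_quotient_finite_iff_bigo:
  fixes f g :: "real \<Rightarrow> real"
  assumes f: "\<forall>\<^sub>F x in at_top. 0 \<le> f x" and g: "\<forall>\<^sub>F x in at_top. 0 < g x"
  shows "Limsup at_top (\<lambda>x. ereal (f x / g x)) < \<infinity> \<longleftrightarrow> f \<in> O(g)"
proof
  assume "Limsup at_top (\<lambda>x. ereal (f x / g x)) < \<infinity>"
  then obtain n :: nat where "Limsup at_top (\<lambda>x. ereal (f x / g x)) < ereal (real n)"
    using less_PInf_Ex_of_nat by auto
  then have "\<forall>\<^sub>F x in at_top. ereal (f x / g x) < ereal (real n)"
    by (rule Limsup_lessD)
  with f g have "\<forall>\<^sub>F x in at_top. norm (f x) \<le> real n * norm (g x)"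
    by eventually_elim (simp add: divide_less_eq)
  then show "f \<in> O(g)" by (rule bigoI)
next
  assume "f \<in> O(g)"
  then obtain C where "\<forall>\<^sub>F x in at_top. norm (f x) \<le> C * norm (g x)"
    by (elim landau_o.bigE)
  with f g have "\<forall>\<^sub>F x in at_top. ereal (f x / g x) \<le> ereal C"
    by eventually_elim (simp add: divide_le_eq)
  then have "Limsup at_top (\<lambda>x. ereal (f x / g x)) \<le> ereal C"
    by (rule Limsup_bounded)
  then show "Limsup at_top (\<lambda>x. ereal (f x / g x)) < \<infinity>"
    by (rule le_less_trans) simp
qed

section \<open>Scale mixtures\<close>

text \<open>
  Only the laws of \<open>Y\<close> and \<open>X\<close> matter, so the independent product is studied on the product
  measure \<open>G \<Otimes>\<^sub>M F\<close>, where conditioning on \<open>Y\<close> is Fubini's theorem.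
\<close>

locale scale_mixture = G: prob_space G + F: prob_space F
  for G :: "real measure" and F :: "(real^'n) measure" +
  assumes sets_G [measurable_cong]: "sets G = sets borel"
    and sets_F [measurable_cong]: "sets F = sets borel"
    and AE_nonneg: "AE y in G. 0 \<le> y"
begin

sublocale pair_prob_space G F ..

definition mix :: "(real^'n) measure" where
  "mix = distr (G \<Otimes>\<^sub>M F) borel (\<lambda>(y, v). y *\<^sub>R v)"

lemma space_G [simp]: "space G = UNIV"
  using sets_eq_imp_space_eq[OF sets_G] by simp

lemma space_F [simp]: "space F = UNIV"
  using sets_eq_imp_space_eq[OF sets_F] by simp

lemma scaleR_measurable_pair [measurable]:
  "(\<lambda>(y, v). y *\<^sub>R v) \<in> borel_measurable (G \<Otimes>\<^sub>M F)"
  by measurable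

lemma prob_space_mix: "prob_space mix"
  unfolding mix_def by (rule prob_space_distr) measurable

lemma sets_mix [simp]: "sets mix = sets borel"
  by (simp add: mix_def)

lemma mtail_mix:
  "mtail mix t x = measure (G \<Otimes>\<^sub>M F) {(y, v). y *\<^sub>R v \<in> tail_set t x}"
  unfolding mtail_eq_measure_tail_set mix_def
  by (subst measure_distr)
     (auto simp: space_pair_measure intro!: arg_cong[where f = "measure (G \<Otimes>\<^sub>M F)"])

lemma mix_event_sets: "{(y, v). y *\<^sub>R v \<in> tail_set t x} \<in> sets (G \<Otimes>\<^sub>M F)"
proof -
  have "(\<lambda>(y, v). y *\<^sub>R v) -` tail_set t x \<inter> space (G \<Otimes>\<^sub>M F) \<in> sets (G \<Otimes>\<^sub>M F)"
    by (rule measurable_sets[OF scaleR_measurable_pair tail_set_measurable])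
  also have "(\<lambda>(y, v). y *\<^sub>R v) -` tail_set t x \<inter> space (G \<Otimes>\<^sub>M F)
      = {(y, v). y *\<^sub>R v \<in> tail_set t x}"
    by (auto simp: space_pair_measure)
  finally show ?thesis .
qed

text \<open>
  Conditioning on the first component: a comparison of events that holds, up to the factor \<open>C\<close>,
  for almost every value of that component holds on average.
\<close>

lemma measure_pair_le_of_sections:
  assumes A: "A \<in> sets (G \<Otimes>\<^sub>M F)" and B: "B \<in> sets (G \<Otimes>\<^sub>M F)" and C: "0 \<le> C"
    and le: "AE y in G. measure F (Pair y -` A) \<le> C * measure F (Pair y -` B)"
  shows "measure (G \<Otimes>\<^sub>M F) A \<le> C * measure (G \<Otimes>\<^sub>M F) B"
proof -
  have "emeasure (G \<Otimes>\<^sub>M F) A = (\<integral>\<^sup>+y. emeasure F (Pair y -` A) \<partial>G)"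
    by (rule F.emeasure_pair_measure_alt[OF A])
  also have "\<dots> \<le> (\<integral>\<^sup>+y. ennreal C * emeasure F (Pair y -` B) \<partial>G)"
  proof (rule nn_integral_mono_AE)
    show "AE y in G. emeasure F (Pair y -` A) \<le> ennreal C * emeasure F (Pair y -` B)"
      using le
      by eventually_elim
         (simp add: F.emeasure_eq_measure C ennreal_leI flip: ennreal_mult)
  qed
  also have "\<dots> = ennreal C * emeasure (G \<Otimes>\<^sub>M F) B"
    using F.measurable_emeasure_Pair[OF B]
    by (simp add: nn_integral_cmult F.emeasure_pair_measure_alt[OF B])
  finally show ?thesis
    by (simp add: emeasure_eq_measure ennreal_mult[OF C, symmetric] C)
qed

lemma measure_factor_event:
  assumes "S \<in> sets borel"
  shows "measure (G \<Otimes>\<^sub>M F) {(y, v). y \<in> S} = measure G S"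
proof -
  have "{(y, v). y \<in> S} = S \<times> space F" by auto
  then show ?thesis
    using assms by (simp add: F.emeasure_pair_measure_Times measure_def sets_G F.emeasure_space_1
        del: space_F)
qed

lemma ccdf_G: "ccdf G c = measure G {c<..}"
  using ccdf_distr_eq_measure[OF G.prob_space_axioms, of "\<lambda>y. y" c] distr_id2[of borel G]
  by (simp add: sets_G greaterThan_def)

text \<open>
  Some \<open>d > 0\<close> is exceeded with positive probability under \<open>G\<close>. On \<open>y > d\<close>, a vector that is
  beyond level \<open>x / d\<close> before scaling is beyond level \<open>x\<close> afterwards, so the joint tail is at
  least a product of two positive numbers.
\<close>

lemma mtail_mix_pos:
  assumes t: "t \<in> directions" and x: "0 \<le> x" and pos: "\<And>u. 0 \<le> u \<Longrightarrow> 0 < mtail F t u"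
    and G0: "0 < ccdf G 0"
  shows "0 < mtail mix t x"
proof -
  have "\<exists>d>0. 0 < measure G {d<..}"
  proof (rule ccontr)
    assume "\<not> ?thesis"
    then have "measure G {d<..} = 0" if "0 < d" for d
      using that by (auto simp: zero_less_measure_iff)
    \<comment> \<open>The positive half-line is a countable union of such half-lines, so it would be null.\<close>
    then have "{1 / Suc n<..} \<in> null_sets G" for n
      by (auto simp: null_sets_def G.emeasure_eq_measure sets_G)
    then have "(\<Union>n. {1 / real (Suc n)<..}) \<in> null_sets G" by blast
    moreover have "(\<Union>n. {1 / real (Suc n)<..}) = {0<..}"
    proof (intro set_eqI iffI)
      fix y :: real assume "y \<in> {0<..}"
      then show "y \<in> (\<Union>n. {1 / real (Suc n)<..})"
        using nat_approx_posE[of y] by auto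
    qed (auto intro: less_trans[of _ "1 / real (Suc _)"])
    ultimately have "measure G {0<..} = 0" by (simp add: measure_eq_0_null_sets)
    with G0 show False by (simp add: ccdf_G)
  qed
  then obtain d where d: "0 < d" "0 < measure G {d<..}" by blast
  let ?A = "{d<..} \<times> tail_set t (x / d)"
  have "0 < measure G {d<..} * measure F (tail_set t (x / d))"
    using d x pos[of "x / d"] by (simp add: mtail_eq_measure_tail_set)
  also have "\<dots> = measure (G \<Otimes>\<^sub>M F) ?A"
    by (simp add: F.emeasure_pair_measure_Times measure_def sets_G sets_F enn2real_mult)
  also have "\<dots> \<le> mtail mix t x"
  proof -
    have "y *\<^sub>R v \<in> tail_set t x" if "d < y" "v \<in> tail_set t (x / d)" for y v
    proof -
      have "x / y \<le> x / d" using d that x by (intro divide_left_mono) auto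
      then show ?thesis
        using tail_set_antimono[OF t] that d scaleR_mem_tail_set_iff[of y v t x] by auto
    qed
    then show ?thesis
      unfolding mtail_mix by (intro finite_measure_mono mix_event_sets) auto
  qed
  finally show ?thesis .
qed

text \<open>
  The transfer principle. The event for \<open>s\<close> is split at \<open>y = a x\<close>. For \<open>0 < y \<le> a x\<close> the levels
  \<open>x / y\<close> are so large that the assumed bound between the tails of \<open>F\<close> applies to every section,
  and integrating it costs only the constant \<open>C\<close>. The part \<open>y > a x\<close> is negligible against the
  tail in direction \<open>t\<close> and adds \<open>1\<close> to the constant.
\<close>

lemma mtail_mix_bigo:
  fixes a :: "real \<Rightarrow> real"
  assumes s: "s \<in> directions"
    and dom: "mtail F s \<in> O(mtail F t)"
    and a: "a \<in> o(\<lambda>x. x)"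
    and tail: "(\<lambda>x. ccdf G (a x)) \<in> o(mtail mix t)"
  shows "mtail mix s \<in> O(mtail mix t)"
proof -
  obtain C where C: "0 < C" "\<forall>\<^sub>F u in at_top. norm (mtail F s u) \<le> C * norm (mtail F t u)"
    using dom by (elim landau_o.bigE)
  then obtain u0 where u0: "mtail F s u \<le> C * mtail F t u" if "u0 \<le> u" for u
    by (auto simp: eventually_at_top_linorder mtail_def)
  \<comment> \<open>A positive threshold, so that \<open>a x \<le> x / w\<close> can be drawn from \<open>a = o(x)\<close>.\<close>
  define w where "w = max 1 u0"
  have w: "0 < w" "u0 \<le> w" by (auto simp: w_def)
  have "\<forall>\<^sub>F x in at_top. norm (a x) \<le> inverse w * norm x"
    using a w by (intro landau_o.smallD) auto
  moreover have "\<forall>\<^sub>F x in at_top. norm (ccdf G (a x)) \<le> 1 * norm (mtail mix t x)"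
    using tail by (intro landau_o.smallD) auto
  moreover have "\<forall>\<^sub>F x in at_top. (0::real) \<le> x" by (rule eventually_ge_at_top)
  ultimately have "\<forall>\<^sub>F x in at_top. norm (mtail mix s x) \<le> (1 + C) * norm (mtail mix t x)"
  proof eventually_elim
    case (elim x)
    let ?S = "{(y, v). y *\<^sub>R v \<in> tail_set s x}" and ?T = "{(y, v). y *\<^sub>R v \<in> tail_set t x}"
    let ?large = "{(y, v :: real^'n). y \<in> {a x<..}}"
    have large: "?large \<in> sets (G \<Otimes>\<^sub>M F)"
    proof -
      have "?large = {a x<..} \<times> UNIV" by auto
      moreover have "UNIV \<in> sets F" using sets.top[of F] by simp
      ultimately show ?thesis by (auto simp: sets_G)
    qed
    have "measure (G \<Otimes>\<^sub>M F) (?S - ?large) \<le> C * measure (G \<Otimes>\<^sub>M F) ?T"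
    proof (rule measure_pair_le_of_sections)
      show "AE y in G. measure F (Pair y -` (?S - ?large)) \<le> C * measure F (Pair y -` ?T)"
        using AE_nonneg
      proof eventually_elim
        case y: (elim y)
        show ?case
        proof (cases "0 < y \<and> y \<le> a x")
          case True
          have "u0 * y \<le> w * y" using True w by simp
          also have "\<dots> \<le> w * \<bar>a x\<bar>" using True w by simp
          also have "\<dots> \<le> x" using elim(1,3) w by (simp add: field_simps)
          finally have "u0 \<le> x / y" using True by (simp add: pos_le_divide_eq)
          then have "mtail F s (x / y) \<le> C * mtail F t (x / y)" by (rule u0)
          moreover have "Pair y -` (?S - ?large) = tail_set s (x / y)"
            and "Pair y -` ?T = tail_set t (x / y)"
            using True by (auto simp: scaleR_mem_tail_set_iff)
          ultimately show ?thesis by (simp add: mtail_eq_measure_tail_set)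
        next
          case False
          \<comment> \<open>Either \<open>y > a x\<close>, which is excluded, or \<open>y = 0\<close>, and the zero vector lies in no tail set.\<close>
          then have "Pair y -` (?S - ?large) = {}"
            using y zero_notin_tail_set[OF s elim(3)] by (cases "y = 0") auto
          then show ?thesis using C by simp
        qed
      qed
    qed (use C large mix_event_sets in auto)
    then have "measure (G \<Otimes>\<^sub>M F) (?S - ?large) \<le> C * mtail mix t x"
      by (simp add: mtail_mix)
    moreover have "measure (G \<Otimes>\<^sub>M F) ?large \<le> mtail mix t x"
      using elim(2) by (subst measure_factor_event) (auto simp: ccdf_G mtail_def)
    moreover have "mtail mix s x \<le> measure (G \<Otimes>\<^sub>M F) ((?S - ?large) \<union> ?large)"
      unfolding mtail_mix using large mix_event_sets by (intro finite_measure_mono) auto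
    moreover have "\<dots> \<le> measure (G \<Otimes>\<^sub>M F) (?S - ?large) + measure (G \<Otimes>\<^sub>M F) ?large"
      using large mix_event_sets by (intro measure_Un_le) auto
    ultimately have "mtail mix s x \<le> (1 + C) * mtail mix t x"
      by (simp add: algebra_simps)
    then show ?case by (simp add: mtail_def)
  qed
  then show ?thesis by (rule bigoI)
qed

text \<open>
  The transfer principle turns each bounded quotient demanded of the mixture into the same one for
  \<open>F\<close>; one marginal of the mixture itself serves as weak kernel.
\<close>

theorem mix_mv_dominatedly_varying:
  fixes a :: "real \<Rightarrow> real"
  assumes F: "F \<in> mv_dominatedly_varying" and G0: "0 < ccdf G 0"
    and a: "a \<in> o(\<lambda>x. x)"
    and tail: "\<And>t. t \<in> directions \<Longrightarrow> (\<lambda>x. ccdf G (a x)) \<in> o(mtail mix t)"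
  shows "mix \<in> mv_dominatedly_varying"
proof -
  have posF: "0 < mtail F t x" if "t \<in> directions" "0 \<le> x" for t x
    using F that by (auto simp: mv_dominatedly_varying_def)
  have pos: "0 < mtail mix t x" if "t \<in> directions" "0 \<le> x" for t x
    using that posF by (intro mtail_mix_pos G0) auto
  have quotient: "Limsup at_top (\<lambda>x. ereal (mtail P s x / mtail P t x)) < \<infinity>
      \<longleftrightarrow> mtail P s \<in> O(mtail P t)"
    if "\<And>x. 0 \<le> x \<Longrightarrow> 0 < mtail P t x" for P :: "(real^'n) measure" and s t
    by (rule Limsup_quotient_finite_iff_bigo)
       (auto simp: mtail_def[of _ s] intro!: eventually_mono[OF eventually_ge_at_top[of 0]] that)
  \<comment> \<open>Transfer with \<open>s = b t\<close>.\<close>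
  have scaled: "mtail mix (scale_direction b t) \<in> O(mtail mix t)"
    if t: "t \<in> directions" and b: "\<And>i. b $ i \<in> {0<..<1}" for b t
  proof (rule mtail_mix_bigo[OF _ _ a tail[OF t]])
    show "scale_direction b t \<in> directions"
      using t b by (intro scale_direction_in_directions) auto
    show "mtail F (scale_direction b t) \<in> O(mtail F t)"
      using F t b posF[OF t] by (subst quotient[symmetric]) (auto simp: mv_dominatedly_varying_def)
  qed
  obtain K where K: "\<And>i. ccdf (marginal F i) \<in> \<Theta>(ccdf K)"
    using F by (auto simp: mv_dominatedly_varying_def)
  \<comment> \<open>Transfer between two coordinate directions; for \<open>F\<close> the comparison goes through the kernel.\<close>
  have marginals: "ccdf (marginal mix i) \<in> O(ccdf (marginal mix j))" for i j
  proof -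
    have "ccdf (marginal F i) \<in> O(ccdf (marginal F j))"
      using K[of i] K[of j] by (meson bigthetaD1 bigthetaD2 bigtheta_sym landau_o.big_trans)
    then show ?thesis
      unfolding ccdf_marginal_eq_mtail[OF prob_space_mix sets_mix]
        ccdf_marginal_eq_mtail[OF F.prob_space_axioms sets_F]
      by (intro mtail_mix_bigo[OF _ _ a tail] axis_direction_in_directions)
  qed
  \<comment> \<open>Which coordinate supplies the kernel is irrelevant, as all marginal tails have the same order.\<close>
  define i0 :: 'n where "i0 = undefined"
  let ?K = "marginal mix i0"
  have "?K \<in> dominatedly_varying"
  proof -
    have "(\<lambda>v. v $ i0) \<in> borel_measurable mix"
      by (subst measurable_cong_sets[OF sets_mix refl]) measurable
    then have "real_distribution ?K"
      unfolding marginal_def by (rule prob_space.real_distribution_distr[OF prob_space_mix])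
    moreover have "Limsup at_top (\<lambda>x. ereal (ccdf ?K (c * x) / ccdf ?K x)) < \<infinity>"
      if "c \<in> {0<..<1}" for c
    proof -
      have "mtail mix (axis_direction i0) (c * x)
          = mtail mix (scale_direction (\<chi> j. c) (axis_direction i0)) x" for x
        using that by (intro mtail_axis_direction_mult) auto
      moreover have "mtail mix (scale_direction (\<chi> j. c) (axis_direction i0))
          \<in> O(mtail mix (axis_direction i0))"
        using that by (intro scaled axis_direction_in_directions) auto
      ultimately show ?thesis
        by (simp add: ccdf_marginal_eq_mtail[OF prob_space_mix sets_mix]
            quotient[OF pos[OF axis_direction_in_directions]] del: less_ereal.simps ereal_infty_less)
    qed
    ultimately show ?thesis
      by (auto simp: dominatedly_varying_def ccdf_marginal_eq_mtail[OF prob_space_mix sets_mix]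
          pos axis_direction_in_directions)
  qed
  moreover have "ccdf (marginal mix i) \<in> \<Theta>(ccdf ?K)" for i
    by (intro bigthetaI marginals) (simp add: marginals bigomega_iff_bigo)
  moreover have "Limsup at_top (\<lambda>x. ereal (mtail mix (scale_direction b t) x / mtail mix t x)) < \<infinity>"
    if "t \<in> directions" "\<forall>i. b $ i \<in> {0<..<1}" for b t
    using that by (subst quotient) (auto intro: pos scaled)
  ultimately show ?thesis
    using prob_space_mix pos by (auto simp: mv_dominatedly_varying_def)
qed

end

section \<open>From independence to mixtures\<close>

text \<open>
  The left limit of a distribution function at a point is the mass strictly below that point.
\<close>

lemma AE_nonneg_of_cdf_tendsto_0_at_left:
  assumes "real_distribution G" and lim: "(cdf G \<longlongrightarrow> 0) (at_left 0)"
  shows "AE y in G. 0 \<le> y"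
proof -
  interpret real_distribution G by fact
  have "measure G {..<0} = 0"
    using cdf_at_left[of 0] lim tendsto_unique[of "at_left (0::real)"] by force
  then have "{..<0} \<in> null_sets G"
    by (auto simp: null_sets_def emeasure_eq_measure)
  then show ?thesis
    by (rule AE_I') auto
qed

text \<open>
  Independence determines the joint law on measurable rectangles, and these determine the measure.
  The two variables may take values in different spaces, here the line and \<open>\<real>\<^sup>n\<close>.
\<close>

lemma (in prob_space) distr_pair_of_indep_vimages:
  assumes [measurable]: "random_variable S Y" "random_variable T X"
    and indep: "indep_set {Y -` A \<inter> space M | A. A \<in> sets S} {X -` B \<inter> space M | B. B \<in> sets T}"
  shows "distr M S Y \<Otimes>\<^sub>M distr M T X = distr M (S \<Otimes>\<^sub>M T) (\<lambda>\<omega>. (Y \<omega>, X \<omega>))"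
proof (rule pair_measure_eqI)
  show "sigma_finite_measure (distr M S Y)" "sigma_finite_measure (distr M T X)"
    by (auto intro!: prob_space_imp_sigma_finite prob_space_distr)
  fix A B assume "A \<in> sets (distr M S Y)" "B \<in> sets (distr M T X)"
  then have [measurable]: "A \<in> sets S" "B \<in> sets T" by auto
  have "emeasure (distr M (S \<Otimes>\<^sub>M T) (\<lambda>\<omega>. (Y \<omega>, X \<omega>))) (A \<times> B)
      = emeasure M ((Y -` A \<inter> space M) \<inter> (X -` B \<inter> space M))"
    by (subst emeasure_distr) (auto intro!: arg_cong[where f = "emeasure M"])
  also have "\<dots> = emeasure M (Y -` A \<inter> space M) * emeasure M (X -` B \<inter> space M)"
    unfolding emeasure_eq_measure
    by (subst indep_setD[OF indep]) (auto simp: ennreal_mult)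
  also have "\<dots> = emeasure (distr M S Y) A * emeasure (distr M T X) B"
    by (simp add: emeasure_distr)
  finally show "emeasure (distr M S Y) A * emeasure (distr M T X) B
      = emeasure (distr M (S \<Otimes>\<^sub>M T) (\<lambda>\<omega>. (Y \<omega>, X \<omega>))) (A \<times> B)" ..
qed simp

theorem theorem5p1:
  fixes M :: "'a measure"
    and X :: "'a \<Rightarrow> real^'n" and Y :: "'a \<Rightarrow> real"
    and F H :: "(real^'n) measure" and G :: "real measure"
    and a :: "real \<Rightarrow> real"
  assumes "prob_space M"
    and "X \<in> borel_measurable M" and "Y \<in> borel_measurable M"
    and "F = distr M borel X" and "G = distr M borel Y"
    and "H = distr M borel (\<lambda>\<omega>. Y \<omega> *\<^sub>R X \<omega>)"
    and "(cdf G \<longlongrightarrow> 0) (at_left 0)" and "cdf G 0 < 1"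
    and "prob_space.indep_set M
           {Y -` A \<inter> space M | A. A \<in> sets borel}
           {X -` B \<inter> space M | B. B \<in> sets borel}"
    and "\<And>x. x \<ge> 0 \<Longrightarrow> a x \<ge> 0"
    and "filterlim a at_top at_top"
    and "a \<in> o(\<lambda>x. x)"
    and "\<And>t. t \<in> directions \<Longrightarrow> (\<lambda>x. ccdf G (a x)) \<in> o(mtail H t)"
    and "F \<in> mv_dominatedly_varying"
  shows "H \<in> mv_dominatedly_varying"
proof -
  interpret M: prob_space M by fact
  note [measurable] = assms(2,3)
  have G: "real_distribution G"
    unfolding assms(5) by (rule M.real_distribution_distr) fact
  interpret scale_mixture G F
  proof (intro scale_mixture.intro scale_mixture_axioms.intro)
    show "prob_space G" "prob_space F"
      unfolding assms(4,5) by (auto intro: M.prob_space_distr)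
    show "sets G = sets borel" "sets F = sets borel"
      unfolding assms(4,5) by (rule sets_distr)+
    show "AE y in G. 0 \<le> y"
      using G assms(7) by (rule AE_nonneg_of_cdf_tendsto_0_at_left)
  qed
  have "G \<Otimes>\<^sub>M F = distr M (borel \<Otimes>\<^sub>M borel) (\<lambda>\<omega>. (Y \<omega>, X \<omega>))"
    unfolding assms(4,5) by (rule M.distr_pair_of_indep_vimages) fact+
  then have "mix = H"
    unfolding mix_def assms(6) by (simp add: distr_distr o_def)
  moreover have "0 < ccdf G 0" using assms(8) by (simp add: ccdf_def)
  ultimately show ?thesis
    using mix_mv_dominatedly_varying[of a] assms(12-14) by simp
qed

end
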